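(* Let $\mathbb{D}_Q\subset\mathbb{M}^d$ be an NC matrix unit ball, where $Q(X)=\sum_{j=1}^dQ_j\otimes X_j$ with $Q_1,\dots,Q_d\in M_{s\times r}$ linearly independent. Let $f\in\mathcal{SA}(\mathbb{D}_Q)$ be a non-constant NC function admitting a unitary realization $$f(X)=A^{(n)}+B^{(n)}\bigl[I-(Q(X)\otimes I_{\mathcal{H}})D^{(n)}\bigr]^{-1}(Q(X)\otimes I_{\mathcal{H}})C^{(n)}$$ for all $n\in\mathbb{N}$ and all $X\in\mathbb{D}_Q\cap(M_{n\times n}\otimes\mathbb{C}^d)$, where $\mathcal{H}$ is a Hilbert space and $$V=\begin{bmatrix}A&B\\ C&D\end{bmatrix}:\begin{bmatrix}\mathbb{C}\\ \mathbb{C}^s\otimes\mathcal{H}\end{bmatrix}\to\begin{bmatrix}\mathbb{C}\\ \mathbb{C}^r\otimes\mathcal{H}\end{bmatrix}$$ is a unitary operator. Then $$\mathcal{Z}_{\mathbb{D}_Q}(f)=\sigma_p^Q(D^* )\cap\mathbb{D}_Q .$$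
   Context: $\mathbb{M}^d=\bigsqcup_{n\in\mathbb{N}}M_{n\times n}\otimes\mathbb{C}^d$ is the disjoint union over $n$ of the spaces of $d$-tuples $X=(X_1,\dots,X_d)$ of complex $n\times n$ matrices (level $n$); for $\Omega\subset\mathbb{M}^d$, $\Omega_n=\Omega\cap(M_{n\times n}\otimes\mathbb{C}^d)$. For $X$ at level $n$, $Q(X)=\sum_jQ_j\otimes X_j:\mathbb{C}^r\otimes\mathbb{C}^n\to\mathbb{C}^s\otimes\mathbb{C}^n$, and $\mathbb{D}_Q=\{X\in\mathbb{M}^d:\|Q(X)\|<1\}$ (operator norm). An NC function $f:\mathbb{D}_Q\to\mathbb{M}^1$ is a map such that: $f(X)\in M_{n\times n}$ for $X$ at level $n$; $f(X\oplus Y)=f(X)\oplus f(Y)$ (direct sums taken componentwise); and $f(S^{-1}XS)=S^{-1}f(X)S$ whenever $X\in(\mathbb{D}_Q)_n$, $S\in GL_n$ and $S^{-1}XS=(S^{-1}X_1S,\dots,S^{-1}X_dS)\in(\mathbb{D}_Q)_n$. $\mathcal{SA}(\mathbb{D}_Q)$ is the set of NC functions $f:\mathbb{D}_Q\to\mathbb{M}^1$ with $\sup_{X\in\mathbb{D}_Q}\|f(X)\|\le1$. For an operator $T$, $T^{(n)}=T\otimes I_n$. For $X$ at level $n$, $Q(X)\otimes I_{\mathcal{H}}$ denotes, after the obvious reordering of tensor factors, the operator $\sum_jQ_j\otimes I_{\mathcal{H}}\otimes X_j:\mathbb{C}^r\otimes\mathcal{H}\otimes\mathbb{C}^n\to\mathbb{C}^s\otimes\mathcal{H}\otimes\mathbb{C}^n$.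 Zero locus: $\mathcal{Z}_{\mathbb{D}_Q}(f)=\{X\in\mathbb{D}_Q:\det f(X)=0\}$; equivalently those $X\in(\mathbb{D}_Q)_n$, $n\in\mathbb{N}$, with $f(X)y=0$ for some $0\ne y\in\mathbb{C}^n$. NC $Q$-eigenvalues: for $T\in\mathcal{B}(\mathbb{C}^r\otimes\mathcal{H},\mathbb{C}^s\otimes\mathcal{H})$, $\Lambda\in M_{n\times n}\otimes\mathbb{C}^d$ is an NC $Q$-eigenvalue of $T$ at level $n$ if there is a non-zero $\vec v\in\mathbb{C}^r\otimes\mathcal{H}\otimes\mathbb{C}^n$ with $T^{(n)}\vec v=(Q(\Lambda)\otimes I_{\mathcal{H}})\vec v$. $\sigma_p^Q(T)$ is the set (disjoint union over $n$) of all NC $Q$-eigenvalues of $T$ at all levels. *)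

theory Defs
  imports "HOL-Analysis.Analysis" "Jordan_Normal_Form.Determinant"
begin

unbundle no vec_syntax
no_notation vec_index (infixl \<open>$\<close> 100)
notation Finite_Cartesian_Product.vec_nth (infixl \<open>$h\<close> 90)
notation Matrix.vec_index (infixl \<open>$v\<close> 100)

hide_const (open) Finite_Cartesian_Product.vec Determinants.det Finite_Cartesian_Product.mat
hide_type (open) Finite_Cartesian_Product.vec

section \<open>Complex Hilbert spaces\<close>

text \<open>The inner product is linear in its first argument. The norm law below also gives
  positivity and definiteness of the inner product.\<close>

class chilbert_space = banach +
  fixes cscale :: "complex \<Rightarrow> 'a \<Rightarrow> 'a" (infixr \<open>*\<^sub>C\<close> 75)
    and cinner :: "'a \<Rightarrow> 'a \<Rightarrow> complex"
  assumes cscale_of_real: "complex_of_real t *\<^sub>C x = t *\<^sub>R x"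
    and cscale_add_right: "a *\<^sub>C (x + y) = a *\<^sub>C x + a *\<^sub>C y"
    and cscale_add_left: "(a + b) *\<^sub>C x = a *\<^sub>C x + b *\<^sub>C x"
    and cscale_cscale: "a *\<^sub>C (b *\<^sub>C x) = (a * b) *\<^sub>C x"
    and cinner_commute: "cinner x y = cnj (cinner y x)"
    and cinner_add_left: "cinner (x + y) z = cinner x z + cinner y z"
    and cinner_cscale_left: "cinner (a *\<^sub>C x) y = a * cinner x y"
    and cinner_self: "cinner x x = complex_of_real ((norm x)\<^sup>2)"

instantiation complex :: chilbert_space
begin

definition cscale_complex :: "complex \<Rightarrow> complex \<Rightarrow> complex" where
  "cscale_complex a x = a * x"

definition cinner_complex :: "complex \<Rightarrow> complex \<Rightarrow> complex" where
  "cinner_complex x y = x * cnj y"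

instance
proof
  fix x :: complex
  show "cinner x x = complex_of_real ((norm x)\<^sup>2)"
    by (simp only: cinner_complex_def complex_norm_square)
qed (simp_all add: cscale_complex_def cinner_complex_def scaleR_conv_of_real algebra_simps)

end

instantiation prod :: (chilbert_space, chilbert_space) chilbert_space
begin

definition cscale_prod :: "complex \<Rightarrow> 'a \<times> 'b \<Rightarrow> 'a \<times> 'b" where
  "cscale_prod a x = (a *\<^sub>C fst x, a *\<^sub>C snd x)"

definition cinner_prod :: "'a \<times> 'b \<Rightarrow> 'a \<times> 'b \<Rightarrow> complex" where
  "cinner_prod x y = cinner (fst x) (fst y) + cinner (snd x) (snd y)"

instance
proof
  fix x y :: "'a \<times> 'b"
  show "cinner x y = cnj (cinner y x)"
    unfolding cinner_prod_def complex_cnj_add by (metis cinner_commute)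
  show "cinner x x = complex_of_real ((norm x)\<^sup>2)"
    by (simp add: cinner_prod_def cinner_self norm_prod_def)
qed (simp_all add: cscale_prod_def cinner_prod_def prod_eq_iff cscale_of_real cscale_add_right
      cscale_add_left cscale_cscale cinner_add_left cinner_cscale_left algebra_simps)

end

instantiation Finite_Cartesian_Product.vec :: (chilbert_space, finite) chilbert_space
begin

definition cscale_vec :: "complex \<Rightarrow> 'a ^ 'b \<Rightarrow> 'a ^ 'b" where
  "cscale_vec a x = vec_lambda (\<lambda>i. a *\<^sub>C (x $h i))"

definition cinner_vec :: "'a ^ 'b \<Rightarrow> 'a ^ 'b \<Rightarrow> complex" where
  "cinner_vec x y = (\<Sum>i\<in>UNIV. cinner (x $h i) (y $h i))"

instance
proof
  fix x y :: "'a ^ 'b"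
  show "cinner x y = cnj (cinner y x)"
    unfolding cinner_vec_def cnj_sum by (metis cinner_commute)
  show "cinner x x = complex_of_real ((norm x)\<^sup>2)"
    by (simp add: cinner_vec_def cinner_self norm_vec_def L2_set_def sum_nonneg)
qed (simp_all add: cscale_vec_def cinner_vec_def Finite_Cartesian_Product.vec_eq_iff cscale_of_real cscale_add_right
      cscale_add_left cscale_cscale cinner_add_left cinner_cscale_left
      sum.distrib sum_distrib_left)

end

definition bounded_clinear :: "('a::chilbert_space \<Rightarrow> 'b::chilbert_space) \<Rightarrow> bool" where
  "bounded_clinear T \<longleftrightarrow> bounded_linear T \<and> (\<forall>a x. T (a *\<^sub>C x) = a *\<^sub>C T x)"

definition unitary_op :: "('a::chilbert_space \<Rightarrow> 'b::chilbert_space) \<Rightarrow> bool" where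
  "unitary_op V \<longleftrightarrow>
     bounded_clinear V \<and> surj V \<and> (\<forall>x y. cinner (V x) (V y) = cinner x y)"

definition cadjoint :: "('a::chilbert_space \<Rightarrow> 'b::chilbert_space) \<Rightarrow> 'b \<Rightarrow> 'a" where
  "cadjoint T = (THE T'. \<forall>x y. cinner (T x) y = cinner x (T' y))"

section \<open>Operators at level \<open>n\<close>\<close>

text \<open>For a Hilbert space \<open>K\<close>, the space \<open>K \<otimes> \<complex>\<^sup>n\<close> is represented as \<open>carrier_vec n\<close> over \<open>K\<close>,
  so that \<open>map_vec T\<close> is the amplification \<open>T \<otimes> I\<^sub>n\<close> of a linear operator \<open>T\<close>.
  The space \<open>\<complex>\<^sup>r \<otimes> H\<close> is represented as \<open>H ^ r\<close>.\<close>

definition l2norm :: "'k::real_normed_vector Matrix.vec \<Rightarrow> real" where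
  "l2norm v = sqrt (\<Sum>i<dim_vec v. (norm (v $v i))\<^sup>2)"

definition op_norm ::
  "nat \<Rightarrow> ('k::real_normed_vector Matrix.vec \<Rightarrow> 'l::real_normed_vector Matrix.vec) \<Rightarrow> real" where
  "op_norm n F = Sup {l2norm (F v) | v. v \<in> carrier_vec n \<and> l2norm v \<le> 1}"

text \<open>\<open>M \<otimes> I\<^sub>H\<close> for an \<open>s \<times> r\<close> matrix \<open>M\<close>.\<close>

definition mat_tensor_id :: "complex ^ 'r ^ 's \<Rightarrow> 'h::chilbert_space ^ 'r \<Rightarrow> 'h ^ 's" where
  "mat_tensor_id M x = vec_lambda (\<lambda>a. \<Sum>b\<in>UNIV. (M $h a $h b) *\<^sub>C (x $h b))"

text \<open>\<open>Q(X) \<otimes> I\<^sub>H = \<Sum>\<^sub>j Q\<^sub>j \<otimes> I\<^sub>H \<otimes> X\<^sub>j\<close> on \<open>\<complex>\<^sup>r \<otimes> H \<otimes> \<complex>\<^sup>n\<close>, where \<open>n = dim_vec v\<close> is the level of \<open>X\<close>.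
  The operator \<open>Q(X)\<close> itself is the case \<open>H = \<complex>\<close>.\<close>

definition Q_op ::
  "('d::finite \<Rightarrow> complex ^ 'r ^ 's) \<Rightarrow> ('d \<Rightarrow> complex mat) \<Rightarrow>
    ('h::chilbert_space ^ 'r) Matrix.vec \<Rightarrow> ('h ^ 's) Matrix.vec" where
  "Q_op Q X v = Matrix.vec (dim_vec v)
     (\<lambda>i. \<Sum>j\<in>UNIV. \<Sum>k<dim_vec v. (X j $$ (i, k)) *\<^sub>C mat_tensor_id (Q j) (v $v k))"

section \<open>The NC universe and NC functions\<close>

definition nc_level :: "nat \<Rightarrow> ('d \<Rightarrow> complex mat) set" where
  "nc_level n = {X. \<forall>j. X j \<in> carrier_mat n n}"

definition nc_ball_level ::
  "('d::finite \<Rightarrow> complex ^ 'r ^ 's) \<Rightarrow> nat \<Rightarrow> ('d \<Rightarrow> complex mat) set" where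
  "nc_ball_level Q n = {X \<in> nc_level n.
     op_norm n (Q_op Q X :: (complex ^ 'r) Matrix.vec \<Rightarrow> (complex ^ 's) Matrix.vec) < 1}"

definition nc_ball :: "('d::finite \<Rightarrow> complex ^ 'r ^ 's) \<Rightarrow> ('d \<Rightarrow> complex mat) set" where
  "nc_ball Q = (\<Union>n\<in>{1..}. nc_ball_level Q n)"

definition mat_dsum :: "complex mat \<Rightarrow> complex mat \<Rightarrow> complex mat" where
  "mat_dsum M N = four_block_mat M (0\<^sub>m (dim_row M) (dim_col N)) (0\<^sub>m (dim_row N) (dim_col M)) N"

definition nc_function ::
  "('d::finite \<Rightarrow> complex ^ 'r ^ 's) \<Rightarrow> (('d \<Rightarrow> complex mat) \<Rightarrow> complex mat) \<Rightarrow> bool" where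
  "nc_function Q f \<longleftrightarrow>
     (\<forall>n\<ge>1. \<forall>X\<in>nc_ball_level Q n. f X \<in> carrier_mat n n) \<and>
     (\<forall>X\<in>nc_ball Q. \<forall>Y\<in>nc_ball Q. f (\<lambda>j. mat_dsum (X j) (Y j)) = mat_dsum (f X) (f Y)) \<and>
     (\<forall>n\<ge>1. \<forall>X\<in>nc_ball_level Q n. \<forall>S\<in>carrier_mat n n. \<forall>S'\<in>carrier_mat n n.
        inverts_mat S S' \<and> inverts_mat S' S \<and> (\<lambda>j. S' * X j * S) \<in> nc_ball_level Q n \<longrightarrow>
        f (\<lambda>j. S' * X j * S) = S' * f X * S)"

definition schur_agler ::
  "('d::finite \<Rightarrow> complex ^ 'r ^ 's) \<Rightarrow> (('d \<Rightarrow> complex mat) \<Rightarrow> complex mat) set" where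
  "schur_agler Q = {f. nc_function Q f \<and>
     (\<forall>n\<ge>1. \<forall>X\<in>nc_ball_level Q n. op_norm n ((*\<^sub>v) (f X)) \<le> 1)}"

text \<open>A constant NC function takes the value \<open>c I\<^sub>n\<close> at every level \<open>n\<close>, with one scalar \<open>c\<close>.\<close>

definition nc_constant ::
  "('d::finite \<Rightarrow> complex ^ 'r ^ 's) \<Rightarrow> (('d \<Rightarrow> complex mat) \<Rightarrow> complex mat) \<Rightarrow> bool" where
  "nc_constant Q f \<longleftrightarrow> (\<exists>c. \<forall>n\<ge>1. \<forall>X\<in>nc_ball_level Q n. f X = c \<cdot>\<^sub>m 1\<^sub>m n)"

definition lin_indep_family :: "('d::finite \<Rightarrow> 'k::chilbert_space) \<Rightarrow> bool" where
  "lin_indep_family Q \<longleftrightarrow> (\<forall>c. (\<Sum>j\<in>UNIV. c j *\<^sub>C Q j) = 0 \<longrightarrow> (\<forall>j. c j = 0))"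

section \<open>Realizations, zero loci and NC eigenvalues\<close>

definition block_op ::
  "(complex \<Rightarrow> complex) \<Rightarrow> ('k::chilbert_space \<Rightarrow> complex) \<Rightarrow>
   (complex \<Rightarrow> 'l::chilbert_space) \<Rightarrow> ('k \<Rightarrow> 'l) \<Rightarrow> complex \<times> 'k \<Rightarrow> complex \<times> 'l" where
  "block_op A B C D = (\<lambda>(x, w). (A x + B w, C x + D w))"

text \<open>The operator
  \<open>A\<^sup>(\<^sup>n\<^sup>) + B\<^sup>(\<^sup>n\<^sup>) [I - (Q(X) \<otimes> I\<^sub>H) D\<^sup>(\<^sup>n\<^sup>)]\<^sup>-\<^sup>1 (Q(X) \<otimes> I\<^sub>H) C\<^sup>(\<^sup>n\<^sup>)\<close> on \<open>\<complex>\<^sup>n\<close>.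
  The bracket is a bijection of \<open>\<complex>\<^sup>s \<otimes> H \<otimes> \<complex>\<^sup>n\<close> whenever \<open>D\<close> is a contraction and \<open>X\<close> lies in the ball.\<close>

definition transfer_op ::
  "('d::finite \<Rightarrow> complex ^ 'r ^ 's) \<Rightarrow> (complex \<Rightarrow> complex) \<Rightarrow>
   ('h::chilbert_space ^ 's \<Rightarrow> complex) \<Rightarrow> (complex \<Rightarrow> 'h ^ 'r) \<Rightarrow> ('h ^ 's \<Rightarrow> 'h ^ 'r) \<Rightarrow>
   nat \<Rightarrow> ('d \<Rightarrow> complex mat) \<Rightarrow> complex Matrix.vec \<Rightarrow> complex Matrix.vec" where
  "transfer_op Q A B C D n X y = map_vec A y +
     map_vec B (the_inv_into (carrier_vec n) (\<lambda>w. w - Q_op Q X (map_vec D w))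
       (Q_op Q X (map_vec C y)))"

definition has_unitary_realization ::
  "('d::finite \<Rightarrow> complex ^ 'r ^ 's) \<Rightarrow> (('d \<Rightarrow> complex mat) \<Rightarrow> complex mat) \<Rightarrow>
   (complex \<Rightarrow> complex) \<Rightarrow> ('h::chilbert_space ^ 's \<Rightarrow> complex) \<Rightarrow>
   (complex \<Rightarrow> 'h ^ 'r) \<Rightarrow> ('h ^ 's \<Rightarrow> 'h ^ 'r) \<Rightarrow> bool" where
  "has_unitary_realization Q f A B C D \<longleftrightarrow>
     bounded_clinear A \<and> bounded_clinear B \<and> bounded_clinear C \<and> bounded_clinear D \<and>
     unitary_op (block_op A B C D) \<and>
     (\<forall>n\<ge>1. \<forall>X\<in>nc_ball_level Q n. \<forall>y\<in>carrier_vec n.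
        f X *\<^sub>v y = transfer_op Q A B C D n X y)"

definition zero_locus ::
  "('d::finite \<Rightarrow> complex ^ 'r ^ 's) \<Rightarrow> (('d \<Rightarrow> complex mat) \<Rightarrow> complex mat) \<Rightarrow>
   ('d \<Rightarrow> complex mat) set" where
  "zero_locus Q f = {X \<in> nc_ball Q. Determinant.det (f X) = 0}"

definition nc_Q_eigenvalue ::
  "('d::finite \<Rightarrow> complex ^ 'r ^ 's) \<Rightarrow> ('h::chilbert_space ^ 'r \<Rightarrow> 'h ^ 's) \<Rightarrow>
   nat \<Rightarrow> ('d \<Rightarrow> complex mat) \<Rightarrow> bool" where
  "nc_Q_eigenvalue Q T n L \<longleftrightarrow> L \<in> nc_level n \<and>
     (\<exists>v\<in>carrier_vec n. v \<noteq> 0\<^sub>v n \<and> map_vec T v = Q_op Q L v)"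

definition nc_point_spectrum ::
  "('d::finite \<Rightarrow> complex ^ 'r ^ 's) \<Rightarrow> ('h::chilbert_space ^ 'r \<Rightarrow> 'h ^ 's) \<Rightarrow>
   ('d \<Rightarrow> complex mat) set" where
  "nc_point_spectrum Q T = (\<Union>n\<in>{1..}. {L. nc_Q_eigenvalue Q T n L})"

end

theory Submission
  imports Defs
begin

text \<open>
  The realization is the solution of a system of state equations.  Write
  \<open>M = Q(X) \<otimes> I\<^sub>H\<close> and let \<open>V\<close>, \<open>C\<close>, \<open>D\<close> and so on act on each of the \<open>n\<close> coordinates.  If \<open>w\<close> is
  the solution of \<open>w = M (C y + D w)\<close> and \<open>v = C y + D w\<close>, then \<open>f(X) y = A y + B w\<close>, so that

  \<open>V (y, w) = (f(X) y, v)\<close> and \<open>w = M v\<close>.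

  Suppose first that \<open>f(X) y = 0\<close> with \<open>y \<noteq> 0\<close>.  Then \<open>V (y, w) = (0, v)\<close>, hence \<open>(y, w) = V\<^sup>* (0, v)\<close>, and
  the second component says \<open>D\<^sup>* v = w = M v\<close>.  Since \<open>V\<close> is isometric, \<open>v\<close> vanishes only if \<open>y\<close>
  does.  Conversely, let \<open>D\<^sup>* v = M v\<close> with \<open>v \<noteq> 0\<close>, and put \<open>w = M v\<close>.  Then \<open>V\<^sup>* (0, v) = (y, w)\<close> for some
  \<open>y\<close>, that is, \<open>A y + B w = 0\<close> and \<open>C y + D w = v\<close>; the state equation holds and \<open>f(X) y = 0\<close>.  Here
  \<open>y = 0\<close> is impossible, because it would give \<open>\<parallel>v\<parallel> = \<parallel>w\<parallel> = \<parallel>M v\<parallel>\<close>, whereas \<open>M\<close> is a strict contraction.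
  This argument is \<open>transfer_op_kernel_iff_eigenvalue\<close>; the passage between \<open>D\<^sup>* v = w\<close> and
  \<open>V (y, w) = (0, v)\<close>, coordinate by coordinate, is \<open>cadjoint_eq_iff_colligation\<close>.

  Two analytic facts support it.  The ball is defined by the norm of \<open>Q(X)\<close> on a finite-dimensional
  space, while the state equation involves \<open>Q(X) \<otimes> I\<^sub>H\<close>; the norm does not grow under this
  amplification (\<open>l2norm_Q_op_le\<close>), as one sees by expanding finitely many vectors of \<open>H\<close> in an
  orthogonal system.  And \<open>I - M D\<close> is a bijection because \<open>\<parallel>M D\<parallel> < 1\<close> (\<open>Neumann_bij_betw\<close>), so that the
  state equation has exactly one solution for every \<open>y\<close>.
\<close>

section \<open>Complex inner product spaces\<close>

lemma cscale_zero_left [simp]: "0 *\<^sub>C (x::'a::chilbert_space) = 0"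
  using cscale_of_real[of 0 x] by simp

lemma cscale_one [simp]: "1 *\<^sub>C (x::'a::chilbert_space) = x"
  using cscale_of_real[of 1 x] by simp

lemma cscale_scaleR: "a *\<^sub>C (t *\<^sub>R x) = t *\<^sub>R (a *\<^sub>C (x::'a::chilbert_space))"
  by (simp flip: cscale_of_real add: cscale_cscale mult.commute)

lemma norm_cscale: "norm (a *\<^sub>C (x::'a::chilbert_space)) = cmod a * norm x"
proof -
  have "complex_of_real ((norm (a *\<^sub>C x))\<^sup>2) = a * cinner x (a *\<^sub>C x)"
    by (simp only: cinner_self[symmetric] cinner_cscale_left)
  also have "cinner x (a *\<^sub>C x) = cnj (a * cinner x x)"
    by (metis cinner_commute cinner_cscale_left)
  finally have "complex_of_real ((norm (a *\<^sub>C x))\<^sup>2) = complex_of_real ((cmod a)\<^sup>2 * (norm x)\<^sup>2)"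
    by (simp add: cinner_self complex_norm_square del: of_real_power)
  then show ?thesis
    by (metis of_real_eq_iff power_mult_distrib power2_eq_iff_nonneg norm_ge_zero mult_nonneg_nonneg)
qed

lemma bounded_linear_cscale: "bounded_linear ((*\<^sub>C) a :: 'a::chilbert_space \<Rightarrow> 'a)"
  by (rule bounded_linear_intro[where K = "cmod a"])
    (simp_all add: cscale_add_right cscale_scaleR norm_cscale mult.commute)

lemma cscale_sum_right: "a *\<^sub>C (\<Sum>i\<in>I. x i) = (\<Sum>i\<in>I. a *\<^sub>C (x i :: 'a::chilbert_space))"
  using linear_sum[OF bounded_linear.linear[OF bounded_linear_cscale]] .

lemma cscale_sum_left: "(\<Sum>i\<in>I. a i) *\<^sub>C (x :: 'a::chilbert_space) = (\<Sum>i\<in>I. a i *\<^sub>C x)"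
  by (induction I rule: infinite_finite_induct) (simp_all add: cscale_add_left)

lemma cinner_zero_left [simp]: "cinner 0 (x::'a::chilbert_space) = 0"
  using cinner_cscale_left[of 0 0 x] by simp

lemma cinner_zero_right [simp]: "cinner (x::'a::chilbert_space) 0 = 0"
  using cinner_commute[of x 0] by simp

lemma cinner_sum_left: "cinner (\<Sum>i\<in>I. x i) (y::'a::chilbert_space) = (\<Sum>i\<in>I. cinner (x i) y)"
  by (induction I rule: infinite_finite_induct) (simp_all add: cinner_add_left)

lemma cinner_diff_left: "cinner (x - y) (z::'a::chilbert_space) = cinner x z - cinner y z"
  using cinner_add_left[of "x - y" y z] by simp

lemma cinner_add_right: "cinner (z::'a::chilbert_space) (x + y) = cinner z x + cinner z y"
  by (metis cinner_commute cinner_add_left complex_cnj_add)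

lemma cinner_right_eqI:
  fixes y z :: "'a::chilbert_space"
  assumes "\<And>x. cinner x y = cinner x z"
  shows "y = z"
proof -
  have "cinner (y - z) (y - z) = cnj (cinner y (y - z) - cinner z (y - z))"
    by (metis cinner_commute cinner_diff_left)
  also have "cinner y (y - z) = cinner z (y - z)"
    using assms by (metis cinner_commute)
  finally show ?thesis by (simp add: cinner_self)
qed

lemma norm_add_orthogonal:
  fixes x y :: "'a::chilbert_space"
  assumes "cinner x y = 0"
  shows "(norm (x + y))\<^sup>2 = (norm x)\<^sup>2 + (norm y)\<^sup>2"
proof -
  have "cinner y x = 0" using assms by (metis cinner_commute complex_cnj_zero)
  with assms have "cinner (x + y) (x + y) = cinner x x + cinner y y"
    by (simp add: cinner_add_left cinner_add_right)
  then show ?thesis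
    unfolding cinner_self by (metis of_real_add of_real_eq_iff)
qed

lemma norm_sum_orthogonal:
  fixes e :: "'i \<Rightarrow> 'a::chilbert_space"
  assumes "finite I" "pairwise (\<lambda>i j. cinner (e i) (e j) = 0) I"
  shows "(norm (\<Sum>i\<in>I. a i *\<^sub>C e i))\<^sup>2 = (\<Sum>i\<in>I. (cmod (a i))\<^sup>2 * (norm (e i))\<^sup>2)"
  using assms
proof (induction I rule: finite_induct)
  case (insert i I)
  have "cinner (e j) (e i) = 0" if "j \<in> I" for j
    using insert that by (auto simp: pairwise_def)
  then have "cinner (\<Sum>j\<in>I. a j *\<^sub>C e j) (a i *\<^sub>C e i) = 0"
    by (simp add: cinner_sum_left cinner_cscale_left)
       (metis (mono_tags, lifting) cinner_commute cinner_cscale_left complex_cnj_zero mult_zero_right sum.neutral)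
  from norm_add_orthogonal[OF this] insert show ?case
    by (simp add: add.commute norm_cscale power_mult_distrib pairwise_insert)
qed simp

text \<open>Gram-Schmidt without normalization.  The vectors \<open>e i\<close> may be zero, so linearly dependent
  families need no separate treatment and the index set stays the same.\<close>

lemma orthogonal_decomposition:
  fixes v :: "'i \<Rightarrow> 'a::chilbert_space"
  assumes "finite I"
  shows "\<exists>e a. pairwise (\<lambda>i j. cinner (e i) (e j) = 0) I \<and>
    (\<forall>i\<in>I. v i = (\<Sum>j\<in>I. a i j *\<^sub>C e j))"
  using assms
proof (induction I rule: finite_induct)
  case empty
  then show ?case by simp
next
  case (insert i I)
  then obtain e a where ortho: "pairwise (\<lambda>j k. cinner (e j) (e k) = 0) I"
    and dec: "\<And>k. k \<in> I \<Longrightarrow> v k = (\<Sum>j\<in>I. a k j *\<^sub>C e j)" by blast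
  \<comment> \<open>If \<open>e j = 0\<close>, this is a division by zero, whose value \<open>0\<close> is as good as any.\<close>
  define c where "c j = cinner (v i) (e j) / complex_of_real ((norm (e j))\<^sup>2)" for j
  define u where "u = v i - (\<Sum>j\<in>I. c j *\<^sub>C e j)"
  have u_ortho: "cinner u (e k) = 0" if "k \<in> I" for k
  proof -
    have "cinner (\<Sum>j\<in>I. c j *\<^sub>C e j) (e k) = (\<Sum>j\<in>I. if j = k then c j * cinner (e k) (e k) else 0)"
      using ortho that
      by (auto simp: cinner_sum_left cinner_cscale_left pairwise_def intro!: sum.cong)
    also have "\<dots> = c k * cinner (e k) (e k)"
      using insert.hyps that by simp
    also have "\<dots> = cinner (v i) (e k)"
      by (cases "e k = 0") (simp_all add: c_def cinner_self)
    finally show ?thesis by (simp add: u_def cinner_diff_left)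
  qed
  let ?e = "e(i := u)"
  let ?a = "\<lambda>k j. if k = i then (if j = i then 1 else c j) else if j = i then 0 else a k j"
  have "pairwise (\<lambda>j k. cinner (?e j) (?e k) = 0) (insert i I)"
    using ortho u_ortho insert.hyps
    by (auto simp: pairwise_def) (metis cinner_commute complex_cnj_zero)
  moreover have "v k = (\<Sum>j\<in>insert i I. ?a k j *\<^sub>C ?e j)" if "k \<in> insert i I" for k
  proof -
    have "(\<Sum>j\<in>I. ?a k j *\<^sub>C ?e j) = (\<Sum>j\<in>I. (if k = i then c j else a k j) *\<^sub>C e j)"
      using insert.hyps by (intro sum.cong) auto
    then show ?thesis
      using that insert.hyps dec[of k] by (auto simp: u_def)
  qed
  ultimately show ?case by (intro exI[of _ ?e] exI[of _ ?a]) blast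
qed

text \<open>A scalar matrix has the same norm bound when its entries act on Hilbert space vectors.  In an
  orthogonal system \<open>e q\<close> that represents all \<open>v p\<close>, both sides split by Pythagoras into a sum over \<open>q\<close>,
  whose terms are scalar instances weighted with \<open>\<parallel>e q\<parallel>\<^sup>2\<close>.\<close>

lemma scalar_bound_imp_vector_bound:
  fixes m :: "'i \<Rightarrow> 'p \<Rightarrow> complex" and v :: "'p \<Rightarrow> 'a::chilbert_space"
  assumes "finite P"
    and scalar: "\<And>a. (\<Sum>i\<in>I. (cmod (\<Sum>p\<in>P. m i p * a p))\<^sup>2) \<le> c * (\<Sum>p\<in>P. (cmod (a p))\<^sup>2)"
  shows "(\<Sum>i\<in>I. (norm (\<Sum>p\<in>P. m i p *\<^sub>C v p))\<^sup>2) \<le> c * (\<Sum>p\<in>P. (norm (v p))\<^sup>2)"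
proof -
  obtain e a where ortho: "pairwise (\<lambda>p q. cinner (e p) (e q) = 0) P"
    and dec: "\<And>p. p \<in> P \<Longrightarrow> v p = (\<Sum>q\<in>P. a p q *\<^sub>C e q)"
    using orthogonal_decomposition[OF \<open>finite P\<close>, of v] by blast
  note pythagoras = norm_sum_orthogonal[OF \<open>finite P\<close> ortho]
  have "(\<Sum>p\<in>P. m i p *\<^sub>C v p) = (\<Sum>q\<in>P. (\<Sum>p\<in>P. m i p * a p q) *\<^sub>C e q)" for i
  proof -
    have "(\<Sum>p\<in>P. m i p *\<^sub>C v p) = (\<Sum>p\<in>P. \<Sum>q\<in>P. (m i p * a p q) *\<^sub>C e q)"
      by (intro sum.cong refl) (simp add: dec cscale_sum_right cscale_cscale)
    then show ?thesis
      by (subst (asm) sum.swap) (simp add: cscale_sum_left)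
  qed
  then have "(\<Sum>i\<in>I. (norm (\<Sum>p\<in>P. m i p *\<^sub>C v p))\<^sup>2)
      = (\<Sum>i\<in>I. \<Sum>q\<in>P. (cmod (\<Sum>p\<in>P. m i p * a p q))\<^sup>2 * (norm (e q))\<^sup>2)"
    by (simp add: pythagoras)
  also have "\<dots> = (\<Sum>q\<in>P. (\<Sum>i\<in>I. (cmod (\<Sum>p\<in>P. m i p * a p q))\<^sup>2) * (norm (e q))\<^sup>2)"
    by (subst sum.swap) (simp add: sum_distrib_right)
  also have "\<dots> \<le> (\<Sum>q\<in>P. (c * (\<Sum>p\<in>P. (cmod (a p q))\<^sup>2)) * (norm (e q))\<^sup>2)"
    by (intro sum_mono mult_right_mono scalar) simp
  also have "\<dots> = c * (\<Sum>p\<in>P. \<Sum>q\<in>P. (cmod (a p q))\<^sup>2 * (norm (e q))\<^sup>2)"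
    by (simp add: sum_distrib_left sum_distrib_right mult_ac) (rule sum.swap)
  also have "\<dots> = c * (\<Sum>p\<in>P. (norm (v p))\<^sup>2)"
    by (simp add: dec pythagoras)
  finally show ?thesis .
qed

section \<open>Block operators on finitely many copies of a space\<close>

lemma l2norm_conv_L2_set: "l2norm v = L2_set (\<lambda>i. norm (v $v i)) {..<dim_vec v}"
  by (simp add: l2norm_def L2_set_def)

lemma l2norm_nonneg [simp]: "0 \<le> l2norm v"
  by (simp add: l2norm_conv_L2_set)

lemma l2norm_power2: "(l2norm v)\<^sup>2 = (\<Sum>i<dim_vec v. (norm (v $v i))\<^sup>2)"
  by (simp add: l2norm_def sum_nonneg)

lemma norm_component_le_l2norm: "i < dim_vec v \<Longrightarrow> norm (v $v i) \<le> l2norm v"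
  unfolding l2norm_conv_L2_set by (rule member_le_L2_set) auto

lemma l2norm_eq_0_iff:
  assumes "v \<in> carrier_vec n"
  shows "l2norm v = 0 \<longleftrightarrow> v = 0\<^sub>v n"
  using assms by (auto simp: l2norm_conv_L2_set L2_set_eq_0_iff)

lemma l2norm_map_vec_le:
  assumes "\<And>x. norm (T x) \<le> norm x"
  shows "l2norm (map_vec T v) \<le> l2norm v"
  unfolding l2norm_conv_L2_set using assms by (auto intro!: L2_set_mono)

lemma l2norm_map_vec_scaleR: "l2norm (map_vec ((*\<^sub>R) t) v) = \<bar>t\<bar> * l2norm v"
  by (auto simp: l2norm_conv_L2_set L2_set_right_distrib intro!: L2_set_cong)

text \<open>Both \<open>Q(X) \<otimes> I\<^sub>H\<close> and its product with the amplification of \<open>D\<close> are matrices of bounded operators.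
  Norm bounds and Neumann series are developed for this common form.\<close>

definition block_matrix_op ::
  "nat \<Rightarrow> (nat \<Rightarrow> nat \<Rightarrow> 'k::real_normed_vector \<Rightarrow> 'l::real_normed_vector) \<Rightarrow>
    'k Matrix.vec \<Rightarrow> 'l Matrix.vec" where
  "block_matrix_op n T w = Matrix.vec n (\<lambda>i. \<Sum>k<n. T i k (w $v k))"

lemma block_matrix_op_carrier [simp]: "block_matrix_op n T w \<in> carrier_vec n"
  by (simp add: block_matrix_op_def)

lemma block_matrix_op_diff:
  assumes "\<And>i k. bounded_linear (T i k)" "v \<in> carrier_vec n" "w \<in> carrier_vec n"
  shows "block_matrix_op n T (v - w) = block_matrix_op n T v - block_matrix_op n T w"
  using assms
  by (auto simp: block_matrix_op_def linear_diff[OF bounded_linear.linear[OF assms(1)]] sum_subtractf)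

lemma block_matrix_op_add:
  assumes "\<And>i k. bounded_linear (T i k)" "v \<in> carrier_vec n" "w \<in> carrier_vec n"
  shows "block_matrix_op n T (v + w) = block_matrix_op n T v + block_matrix_op n T w"
  using assms
  by (auto simp: block_matrix_op_def linear_add[OF bounded_linear.linear[OF assms(1)]] sum.distrib)

lemma block_matrix_op_scaleR:
  assumes "\<And>i k. bounded_linear (T i k)" "v \<in> carrier_vec n"
  shows "block_matrix_op n T (map_vec ((*\<^sub>R) t) v) = map_vec ((*\<^sub>R) t) (block_matrix_op n T v)"
  using assms
  by (auto simp: block_matrix_op_def linear_scale[OF bounded_linear.linear[OF assms(1)]] scaleR_right.sum)

lemma block_matrix_op_bounded:
  assumes T: "\<And>i k. bounded_linear (T i k)"
  shows "\<exists>K. \<forall>w\<in>carrier_vec n. l2norm (block_matrix_op n T w) \<le> K * l2norm w"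
proof (intro exI ballI)
  fix w :: "'a Matrix.vec" assume w: "w \<in> carrier_vec n"
  have "l2norm (block_matrix_op n T w) \<le> (\<Sum>i<n. norm (\<Sum>k<n. T i k (w $v k)))"
    unfolding l2norm_conv_L2_set block_matrix_op_def
    by (intro order_trans[OF L2_set_le_sum]) auto
  also have "\<dots> \<le> (\<Sum>i<n. \<Sum>k<n. onorm (T i k) * l2norm w)"
  proof (intro sum_mono order_trans[OF norm_sum])
    fix i k assume "k \<in> {..<n}"
    then have "norm (w $v k) \<le> l2norm w"
      using w by (intro norm_component_le_l2norm) auto
    then show "norm (T i k (w $v k)) \<le> onorm (T i k) * l2norm w"
      by (meson T onorm onorm_pos_le mult_left_mono order_trans)
  qed
  finally show "l2norm (block_matrix_op n T w) \<le> (\<Sum>i<n. \<Sum>k<n. onorm (T i k)) * l2norm w"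
    by (simp add: sum_distrib_right)
qed

text \<open>The operator norm is a supremum in \<open>\<real>\<close>, which says something only if the set is bounded above;
  here this holds because there are finitely many bounded blocks.\<close>

lemma
  assumes T: "\<And>i k. bounded_linear (T i k)"
    and F: "\<And>v. v \<in> carrier_vec n \<Longrightarrow> F v = block_matrix_op n T v"
  shows op_norm_nonneg: "0 \<le> op_norm n F"
    and l2norm_le_op_norm: "v \<in> carrier_vec n \<Longrightarrow> l2norm (F v) \<le> op_norm n F * l2norm v"
proof -
  let ?S = "{l2norm (F v) | v. v \<in> carrier_vec n \<and> l2norm v \<le> 1}"
  obtain K where "\<forall>w\<in>carrier_vec n. l2norm (block_matrix_op n T w) \<le> K * l2norm w"
    using block_matrix_op_bounded[where T = T and n = n, OF T] by blast
  note K = bspec[OF this]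
  have "l2norm (F w) \<le> \<bar>K\<bar>" if "w \<in> carrier_vec n" "l2norm w \<le> 1" for w
  proof -
    have "l2norm (F w) \<le> \<bar>K\<bar> * l2norm w"
      using K[OF that(1)] F[OF that(1)] by (smt (verit) l2norm_nonneg mult_right_mono)
    also have "\<dots> \<le> \<bar>K\<bar> * 1" using that by (intro mult_left_mono) auto
    finally show ?thesis by simp
  qed
  then have bdd: "bdd_above ?S" by (auto intro!: bdd_aboveI)
  have upper: "l2norm (F w) \<le> op_norm n F" if "w \<in> carrier_vec n" "l2norm w \<le> 1" for w
    unfolding op_norm_def using that by (intro cSup_upper[OF _ bdd]) auto
  have "l2norm (0\<^sub>v n :: 'a Matrix.vec) = 0" by (simp add: l2norm_eq_0_iff[of _ n])
  with upper[of "0\<^sub>v n"] show "0 \<le> op_norm n F"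
    by (metis l2norm_nonneg order_trans zero_carrier_vec zero_le_one)
  assume v: "v \<in> carrier_vec n"
  show "l2norm (F v) \<le> op_norm n F * l2norm v"
  proof (cases "l2norm v = 0")
    case True
    then show ?thesis using K[OF v] F[OF v] by simp
  next
    case False
    let ?u = "map_vec ((*\<^sub>R) (1 / l2norm v)) v"
    have u: "?u \<in> carrier_vec n" using v by simp
    have "l2norm (F ?u) \<le> op_norm n F"
      using False by (intro upper u) (simp add: l2norm_map_vec_scaleR)
    moreover have "l2norm (F ?u) = l2norm (F v) / l2norm v"
      by (simp add: F[OF u] F[OF v] block_matrix_op_scaleR[where T = T, OF T v] l2norm_map_vec_scaleR)
    ultimately show ?thesis
      using False l2norm_nonneg[of v] by (simp add: divide_le_eq)
  qed
qed

lemma contraction_fixed_imp_zero: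
  fixes x q :: real
  assumes "x \<le> q * x" "0 \<le> x" "q < 1"
  shows "x = 0"
proof -
  have "(1 - q) * x \<le> 0" using assms(1) by (simp add: left_diff_distrib)
  with assms show ?thesis by (simp add: mult_le_0_iff)
qed

text \<open>Injectivity is immediate from the contraction estimate.  Surjectivity uses the series
  \<open>\<Sum>m. F\<^sup>m b\<close>, summed in each coordinate, since the coordinate space is the complete one.\<close>

lemma Neumann_bij_betw:
  fixes T :: "nat \<Rightarrow> nat \<Rightarrow> 'k::banach \<Rightarrow> 'k"
  assumes T: "\<And>i k. bounded_linear (T i k)"
    and "0 \<le> q" "q < 1"
    and contr: "\<And>w. w \<in> carrier_vec n \<Longrightarrow> l2norm (block_matrix_op n T w) \<le> q * l2norm w"
  shows "bij_betw (\<lambda>w. w - block_matrix_op n T w) (carrier_vec n) (carrier_vec n)"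
proof (rule bij_betw_imageI)
  let ?F = "block_matrix_op n T"
  show "inj_on (\<lambda>w. w - ?F w) (carrier_vec n)"
  proof (rule inj_onI)
    fix v w :: "'k Matrix.vec"
    assume v: "v \<in> carrier_vec n" and w: "w \<in> carrier_vec n" and eq: "v - ?F v = w - ?F w"
    have comp: "v $v i - ?F v $v i = w $v i - ?F w $v i" if "i < n" for i
      using arg_cong[OF eq, of "\<lambda>u. u $v i"] that v w by (simp add: block_matrix_op_def)
    have "v - w = ?F (v - w)"
      unfolding block_matrix_op_diff[where T = T, OF T v w]
    proof (rule eq_vecI)
      fix i assume "i < dim_vec (?F v - ?F w)"
      then have "i < n" by (simp add: block_matrix_op_def)
      with comp[OF this] v w show "(v - w) $v i = (?F v - ?F w) $v i"
        by (simp add: block_matrix_op_def algebra_simps)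
    qed (use v w in \<open>simp add: block_matrix_op_def\<close>)
    then have "l2norm (v - w) \<le> q * l2norm (v - w)"
      using contr[of "v - w"] v w by simp
    then have "l2norm (v - w) = 0"
      using \<open>q < 1\<close> by (intro contraction_fixed_imp_zero) auto
    then have "v - w = 0\<^sub>v n" using v w by (simp add: l2norm_eq_0_iff[of _ n])
    then have "(v - w) $v i = 0" if "i < n" for i using that by simp
    then show "v = w" using v w by (intro eq_vecI) auto
  qed
  show "(\<lambda>w. w - ?F w) ` carrier_vec n = carrier_vec n"
  proof (intro equalityI subsetI)
    fix b :: "'k Matrix.vec" assume b: "b \<in> carrier_vec n"
    define d where "d m = (?F ^^ m) b" for m
    have d_Suc: "d (Suc m) = ?F (d m)" for m by (simp add: d_def)
    have d_carrier: "d m \<in> carrier_vec n" for m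
      by (cases m) (simp_all add: d_def b)
    have d_bound: "l2norm (d m) \<le> q ^ m * l2norm b" for m
    proof (induction m)
      case (Suc m)
      have "l2norm (d (Suc m)) \<le> q * l2norm (d m)"
        by (simp add: d_Suc contr d_carrier)
      also have "\<dots> \<le> q * (q ^ m * l2norm b)"
        by (intro mult_left_mono Suc \<open>0 \<le> q\<close>)
      finally show ?case by (simp add: mult.assoc)
    qed (simp add: d_def)
    have summable: "summable (\<lambda>m. d m $v i)" if "i < n" for i
    proof (rule summable_comparison_test')
      show "summable (\<lambda>m. q ^ m * l2norm b)"
        using \<open>0 \<le> q\<close> \<open>q < 1\<close> by (intro summable_mult2 summable_geometric) simp
      show "norm (d m $v i) \<le> q ^ m * l2norm b" for m
        using d_carrier[of m] that d_bound[of m] norm_component_le_l2norm[of i "d m"] by auto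
    qed
    define w where "w = Matrix.vec n (\<lambda>i. \<Sum>m. d m $v i)"
    have "w - ?F w = b"
    proof (rule eq_vecI)
      fix i assume "i < dim_vec b"
      then have i: "i < n" using b by simp
      have "?F w $v i = (\<Sum>k<n. T i k (\<Sum>m. d m $v k))"
        using i by (simp add: block_matrix_op_def w_def)
      also have "\<dots> = (\<Sum>k<n. \<Sum>m. T i k (d m $v k))"
        by (intro sum.cong refl bounded_linear.suminf[OF T summable]) auto
      also have "\<dots> = (\<Sum>m. \<Sum>k<n. T i k (d m $v k))"
        by (rule suminf_sum[symmetric]) (auto intro!: bounded_linear.summable[OF T summable])
      also have "\<dots> = (\<Sum>m. d (Suc m) $v i)"
        using i by (simp add: d_Suc block_matrix_op_def)
      also have "\<dots> = (\<Sum>m. d m $v i) - d 0 $v i"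
        by (rule suminf_split_head[OF summable[OF i]])
      finally show "(w - ?F w) $v i = b $v i"
        using i by (simp add: w_def d_def block_matrix_op_def)
    qed (use b in \<open>simp add: block_matrix_op_def\<close>)
    then show "b \<in> (\<lambda>w. w - ?F w) ` carrier_vec n"
      by (intro image_eqI[of _ _ w]) (auto simp: w_def)
  qed auto
qed
section \<open>The operator \<open>Q(X) \<otimes> I\<^sub>H\<close>\<close>

lemma bounded_linear_mat_tensor_id:
  fixes M :: "complex ^ 'r ^ 's"
  shows "bounded_linear (mat_tensor_id M :: 'h::chilbert_space ^ 'r \<Rightarrow> 'h ^ 's)"
proof (rule bounded_linear_intro)
  fix x y :: "'h ^ 'r" and t :: real
  show "mat_tensor_id M (x + y) = mat_tensor_id M x + mat_tensor_id M y"
    by (simp add: mat_tensor_id_def Finite_Cartesian_Product.vec_eq_iff cscale_add_right sum.distrib)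
  show "mat_tensor_id M (t *\<^sub>R x) = t *\<^sub>R mat_tensor_id M x"
    by (simp add: mat_tensor_id_def Finite_Cartesian_Product.vec_eq_iff cscale_scaleR scaleR_right.sum)
  have "norm (mat_tensor_id M x) \<le> (\<Sum>a\<in>UNIV. norm (\<Sum>b\<in>UNIV. (M $h a $h b) *\<^sub>C (x $h b)))"
    unfolding norm_vec_def mat_tensor_id_def by (intro order_trans[OF L2_set_le_sum]) auto
  also have "\<dots> \<le> (\<Sum>a\<in>UNIV. \<Sum>b\<in>UNIV. cmod (M $h a $h b) * norm x)"
    by (intro sum_mono order_trans[OF norm_sum])
      (simp add: norm_cscale mult_left_mono Finite_Cartesian_Product.norm_nth_le)
  finally show "norm (mat_tensor_id M x) \<le> norm x * (\<Sum>a\<in>UNIV. \<Sum>b\<in>UNIV. cmod (M $h a $h b))"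
    by (simp add: sum_distrib_left sum_distrib_right mult.commute)
qed

definition Q_block ::
  "('d::finite \<Rightarrow> complex ^ 'r ^ 's) \<Rightarrow> ('d \<Rightarrow> complex mat) \<Rightarrow> nat \<Rightarrow> nat \<Rightarrow>
    'h::chilbert_space ^ 'r \<Rightarrow> 'h ^ 's" where
  "Q_block Q X i k x = (\<Sum>j\<in>UNIV. (X j $$ (i, k)) *\<^sub>C mat_tensor_id (Q j) x)"

lemma bounded_linear_Q_block: "bounded_linear (Q_block Q X i k)"
  unfolding Q_block_def
  by (intro bounded_linear_sum bounded_linear_compose[OF bounded_linear_cscale]
      bounded_linear_mat_tensor_id)

lemma Q_op_conv_block_matrix_op:
  "v \<in> carrier_vec n \<Longrightarrow> Q_op Q X v = block_matrix_op n (Q_block Q X) v"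
  unfolding Q_op_def block_matrix_op_def Q_block_def
  by (intro eq_vecI) (auto intro: sum.swap)

lemma Q_op_carrier [simp]: "v \<in> carrier_vec n \<Longrightarrow> Q_op Q X v \<in> carrier_vec n"
  by (simp add: Q_op_conv_block_matrix_op)

text \<open>The entries of the scalar matrix \<open>Q(X)\<close>, with rows and columns indexed by pairs of a coordinate
  of \<open>\<complex>\<^sup>n\<close> and a coordinate of \<open>\<complex>\<^sup>s\<close> or \<open>\<complex>\<^sup>r\<close>.\<close>

definition Q_entry ::
  "('d::finite \<Rightarrow> complex ^ 'r ^ 's) \<Rightarrow> ('d \<Rightarrow> complex mat) \<Rightarrow> nat \<times> 's \<Rightarrow> nat \<times> 'r \<Rightarrow> complex" where
  "Q_entry Q X = (\<lambda>(i, a) (k, b). \<Sum>j\<in>UNIV. X j $$ (i, k) * Q j $h a $h b)"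

lemma Q_op_component:
  fixes v :: "('h::chilbert_space ^ 'r) Matrix.vec"
  assumes "v \<in> carrier_vec n" "i < n"
  shows "Q_op Q X v $v i $h a
    = (\<Sum>(k, b)\<in>{..<n} \<times> UNIV. Q_entry Q X (i, a) (k, b) *\<^sub>C (v $v k $h b))"
proof -
  have "Q_block Q X i k x $h a = (\<Sum>b\<in>UNIV. Q_entry Q X (i, a) (k, b) *\<^sub>C (x $h b))"
    for k and x :: "'h ^ 'r"
    unfolding Q_block_def Q_entry_def mat_tensor_id_def cscale_vec_def
    by (simp add: cscale_sum_right cscale_sum_left cscale_cscale) (rule sum.swap)
  then show ?thesis
    using assms by (simp add: Q_op_conv_block_matrix_op block_matrix_op_def flip: sum.cartesian_product)
qed

lemma l2norm_power2_components:
  fixes v :: "('h::chilbert_space ^ 'r) Matrix.vec"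
  assumes "v \<in> carrier_vec n"
  shows "(l2norm v)\<^sup>2 = (\<Sum>(k, b)\<in>{..<n} \<times> UNIV. (norm (v $v k $h b))\<^sup>2)"
  using assms
  by (simp add: l2norm_power2 norm_vec_def L2_set_def sum_nonneg flip: sum.cartesian_product)

text \<open>Tensoring with \<open>I\<^sub>H\<close> does not increase the norm: in coordinates, \<open>Q(X)\<close> and \<open>Q(X) \<otimes> I\<^sub>H\<close> have the
  same scalar entries, which act on numbers in one case and on vectors of \<open>H\<close> in the other.\<close>

lemma l2norm_Q_op_le:
  fixes Q :: "'d::finite \<Rightarrow> complex ^ 'r ^ 's" and v :: "('h::chilbert_space ^ 'r) Matrix.vec"
  assumes v: "v \<in> carrier_vec n"
  shows "l2norm (Q_op Q X v)
    \<le> op_norm n (Q_op Q X :: (complex ^ 'r) Matrix.vec \<Rightarrow> (complex ^ 's) Matrix.vec) * l2norm v"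
    (is "_ \<le> ?c * _")
proof -
  let ?P = "{..<n} \<times> (UNIV :: 'r set)" and ?I = "{..<n} \<times> (UNIV :: 's set)"
  have c: "0 \<le> ?c"
    by (rule op_norm_nonneg[where T = "Q_block Q X", OF bounded_linear_Q_block Q_op_conv_block_matrix_op])
  have scalar: "(\<Sum>i\<in>?I. (cmod (\<Sum>p\<in>?P. Q_entry Q X i p * a p))\<^sup>2) \<le> ?c\<^sup>2 * (\<Sum>p\<in>?P. (cmod (a p))\<^sup>2)"
    for a :: "nat \<times> 'r \<Rightarrow> complex"
  proof -
    define u :: "(complex ^ 'r) Matrix.vec" where
      "u = Matrix.vec n (\<lambda>k. vec_lambda (\<lambda>b. a (k, b)))"
    have u: "u \<in> carrier_vec n" by (simp add: u_def)
    have "l2norm (Q_op Q X u) \<le> ?c * l2norm u"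
      by (rule l2norm_le_op_norm[where T = "Q_block Q X", OF bounded_linear_Q_block Q_op_conv_block_matrix_op u])
    then have "(l2norm (Q_op Q X u))\<^sup>2 \<le> ?c\<^sup>2 * (l2norm u)\<^sup>2"
      by (metis l2norm_nonneg power_mono power_mult_distrib)
    moreover have "Q_op Q X u $v i $h b = (\<Sum>p\<in>?P. Q_entry Q X (i, b) p * a p)" if "i < n" for i b
      unfolding Q_op_component[OF u that]
      by (auto simp: u_def cscale_complex_def intro!: sum.cong)
    then have "(l2norm (Q_op Q X u))\<^sup>2 = (\<Sum>i\<in>?I. (cmod (\<Sum>p\<in>?P. Q_entry Q X i p * a p))\<^sup>2)"
      unfolding l2norm_power2_components[OF Q_op_carrier[OF u]]
      by (auto intro!: sum.cong)
    moreover have "(l2norm u)\<^sup>2 = (\<Sum>p\<in>?P. (cmod (a p))\<^sup>2)"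
      unfolding l2norm_power2_components[OF u] by (auto simp: u_def intro!: sum.cong)
    ultimately show ?thesis by simp
  qed
  have "(l2norm (Q_op Q X v))\<^sup>2
      = (\<Sum>i\<in>?I. (norm (\<Sum>p\<in>?P. Q_entry Q X i p *\<^sub>C (v $v fst p $h snd p)))\<^sup>2)"
    unfolding l2norm_power2_components[OF Q_op_carrier[OF v]]
    by (auto simp: Q_op_component[OF v] case_prod_unfold intro!: sum.cong)
  also have "\<dots> \<le> ?c\<^sup>2 * (\<Sum>p\<in>?P. (norm (v $v fst p $h snd p))\<^sup>2)"
    by (rule scalar_bound_imp_vector_bound[OF _ scalar]) simp
  also have "\<dots> = (?c * l2norm v)\<^sup>2"
    by (simp add: l2norm_power2_components[OF v] power_mult_distrib case_prod_unfold)
  finally show ?thesis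
    by (rule power2_le_imp_le) (simp add: c)
qed

section \<open>Unitary colligations\<close>

lemma cadjoint_eqI:
  assumes "\<And>x y. cinner (T x) y = cinner x (T' y)"
  shows "cadjoint T = T'"
  unfolding cadjoint_def
proof (rule the_equality)
  fix S assume "\<forall>x y. cinner (T x) y = cinner x (S y)"
  then have "cinner x (S y) = cinner x (T' y)" for x y
    unfolding assms by simp
  then show "S = T'" by (rule ext[OF cinner_right_eqI])
qed (use assms in blast)

lemma unitary_op_norm: "unitary_op V \<Longrightarrow> norm (V z) = norm z"
  unfolding unitary_op_def using cinner_self[of "V z"] cinner_self[of z]
  by (metis norm_ge_zero of_real_eq_iff power2_eq_iff_nonneg)

lemma unitary_op_inv: "unitary_op V \<Longrightarrow> V (inv_into UNIV V z) = z"
  unfolding unitary_op_def by (simp add: surj_f_inv_f)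

lemma colligation_norm:
  assumes "unitary_op (block_op A B C D)"
  shows "(norm (A x + B w))\<^sup>2 + (norm (C x + D w))\<^sup>2 = (norm x)\<^sup>2 + (norm w)\<^sup>2"
  using unitary_op_norm[OF assms, of "(x, w)"]
  by (simp add: block_op_def norm_prod_def)

text \<open>The inverse of a unitary \<open>V\<close> is its adjoint, and the lower right corner of \<open>V\<^sup>*\<close> is \<open>D\<^sup>*\<close>.  The
  assumptions \<open>A 0 = 0\<close> and \<open>C 0 = 0\<close> stand for linearity: they give \<open>V (0, x) = (B x, D x)\<close>.\<close>

lemma colligation_cadjoint:
  assumes V: "unitary_op (block_op A B C D)" and "A 0 = 0" "C 0 = 0"
  shows "cadjoint D v = snd (inv_into UNIV (block_op A B C D) (0, v))"
proof -
  let ?V = "block_op A B C D"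
  have "cinner (D x) y = cinner x (snd (inv_into UNIV ?V (0, y)))" for x y
  proof -
    have "cinner (D x) y = cinner (?V (0, x)) (0, y)"
      by (simp add: block_op_def assms cinner_prod_def)
    also have "\<dots> = cinner (?V (0, x)) (?V (inv_into UNIV ?V (0, y)))"
      by (simp add: unitary_op_inv[OF V])
    also have "\<dots> = cinner (0, x) (inv_into UNIV ?V (0, y))"
      using V unfolding unitary_op_def by blast
    finally show ?thesis by (simp add: cinner_prod_def)
  qed
  then show ?thesis by (simp add: cadjoint_eqI)
qed

text \<open>The link between eigenvectors of \<open>D\<^sup>*\<close> and zeros: \<open>D\<^sup>* v = w\<close> means that \<open>V\<close> maps some \<open>(y, w)\<close> to \<open>(0, v)\<close>.\<close>

lemma cadjoint_eq_iff_colligation: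
  assumes V: "unitary_op (block_op A B C D)" and "A 0 = 0" "C 0 = 0"
  shows "cadjoint D v = w \<longleftrightarrow> (\<exists>y. A y + B w = 0 \<and> C y + D w = v)"
proof
  let ?V = "block_op A B C D"
  assume "cadjoint D v = w"
  then have "inv_into UNIV ?V (0, v) = (fst (inv_into UNIV ?V (0, v)), w)"
    by (simp add: colligation_cadjoint[OF assms] prod_eq_iff)
  then have "?V (fst (inv_into UNIV ?V (0, v)), w) = (0, v)"
    by (metis unitary_op_inv[OF V])
  then show "\<exists>y. A y + B w = 0 \<and> C y + D w = v"
    by (auto simp: block_op_def)
next
  let ?V = "block_op A B C D"
  assume "\<exists>y. A y + B w = 0 \<and> C y + D w = v"
  then obtain y where y: "?V (y, w) = (0, v)" by (auto simp: block_op_def)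
  have "inj ?V"
  proof (rule injI)
    fix z z' assume "?V z = ?V z'"
    moreover have "?V (z - z') = ?V z - ?V z'"
      using V by (simp add: unitary_op_def bounded_clinear_def linear_diff bounded_linear.linear)
    ultimately show "z = z'"
      using unitary_op_norm[OF V, of "z - z'"] by simp
  qed
  then have "inv_into UNIV ?V (0, v) = (y, w)" using y by (metis inv_f_f)
  then show "cadjoint D v = w" by (simp add: colligation_cadjoint[OF assms])
qed

section \<open>Zeros of the transfer function\<close>

lemma transfer_op_bij_betw:
  fixes Q :: "'d::finite \<Rightarrow> complex ^ 'r ^ 's" and D :: "'h::chilbert_space ^ 's \<Rightarrow> 'h ^ 'r"
  assumes X: "X \<in> nc_ball_level Q n"
    and D: "bounded_linear D" "\<And>w. norm (D w) \<le> norm w"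
  shows "bij_betw (\<lambda>w. w - Q_op Q X (map_vec D w)) (carrier_vec n) (carrier_vec n)"
proof -
  let ?c = "op_norm n (Q_op Q X :: (complex ^ 'r) Matrix.vec \<Rightarrow> (complex ^ 's) Matrix.vec)"
  let ?T = "\<lambda>i k w. Q_block Q X i k (D w)"
  have c: "0 \<le> ?c" "?c < 1"
    using X by (auto simp: nc_ball_level_def
        intro: op_norm_nonneg[where T = "Q_block Q X", OF bounded_linear_Q_block Q_op_conv_block_matrix_op])
  have T: "bounded_linear (?T i k)" for i k
    using bounded_linear_compose[OF bounded_linear_Q_block D(1)] .
  have eq: "Q_op Q X (map_vec D w) = block_matrix_op n ?T w" if "w \<in> carrier_vec n" for w
    using that by (auto simp: Q_op_conv_block_matrix_op[of _ n] block_matrix_op_def)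
  have "l2norm (block_matrix_op n ?T w) \<le> ?c * l2norm w" if w: "w \<in> carrier_vec n" for w
  proof -
    have "l2norm (Q_op Q X (map_vec D w)) \<le> ?c * l2norm (map_vec D w)"
      using w by (intro l2norm_Q_op_le) simp
    also have "\<dots> \<le> ?c * l2norm w"
      by (intro mult_left_mono l2norm_map_vec_le D c)
    finally show ?thesis by (simp add: eq w)
  qed
  from Neumann_bij_betw[where T = ?T, OF T c this]
  show ?thesis by (simp add: eq cong: bij_betw_cong)
qed

lemma minus_eq_iff_vec:
  fixes a b c :: "'a::ab_group_add Matrix.vec"
  assumes "a \<in> carrier_vec n" "b \<in> carrier_vec n" "c \<in> carrier_vec n"
  shows "a - b = c \<longleftrightarrow> a = c + b"
  using assms by (auto simp: vec_eq_iff diff_eq_eq)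

text \<open>The inverse in the transfer function solves an equation for the state \<open>w\<close>.  In the form on the
  right, the vector \<open>C y + D w\<close> to which \<open>Q(X)\<close> is applied is the lower component of \<open>V (y, w)\<close>.\<close>

lemma state_equation_iff:
  fixes D :: "'h::chilbert_space ^ 's \<Rightarrow> 'h ^ 'r"
  assumes "y \<in> carrier_vec n" "w \<in> carrier_vec n"
  shows "w - Q_op Q X (map_vec D w) = Q_op Q X (map_vec C y)
    \<longleftrightarrow> w = Q_op Q X (map_vec C y + map_vec D w)"
proof -
  have "Q_op Q X (map_vec C y + map_vec D w) = Q_op Q X (map_vec C y) + Q_op Q X (map_vec D w)"
    using assms by (simp add: Q_op_conv_block_matrix_op[of _ n] block_matrix_op_add bounded_linear_Q_block)
  with assms show ?thesis by (simp add: minus_eq_iff_vec[of _ n])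
qed

lemma transfer_op_eqI:
  fixes D :: "'h::chilbert_space ^ 's \<Rightarrow> 'h ^ 'r"
  assumes bij: "bij_betw (\<lambda>w. w - Q_op Q X (map_vec D w)) (carrier_vec n) (carrier_vec n)"
    and y: "y \<in> carrier_vec n" and w: "w \<in> carrier_vec n"
    and state: "w = Q_op Q X (map_vec C y + map_vec D w)"
  shows "transfer_op Q A B C D n X y = map_vec A y + map_vec B w"
proof -
  have "the_inv_into (carrier_vec n) (\<lambda>w. w - Q_op Q X (map_vec D w)) (Q_op Q X (map_vec C y)) = w"
    by (rule the_inv_into_f_eq[OF bij_betw_imp_inj_on[OF bij] iffD2[OF state_equation_iff[OF y w] state] w])
  then show ?thesis by (simp add: transfer_op_def)
qed

lemma state_equation_solvable:
  fixes D :: "'h::chilbert_space ^ 's \<Rightarrow> 'h ^ 'r"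
  assumes bij: "bij_betw (\<lambda>w. w - Q_op Q X (map_vec D w)) (carrier_vec n) (carrier_vec n)"
    and y: "y \<in> carrier_vec n"
  obtains w where "w \<in> carrier_vec n" "w = Q_op Q X (map_vec C y + map_vec D w)"
proof -
  have "Q_op Q X (map_vec C y) \<in> (\<lambda>w. w - Q_op Q X (map_vec D w)) ` carrier_vec n"
    using bij y by (simp add: bij_betw_imp_surj_on)
  then obtain w where "w \<in> carrier_vec n" "w - Q_op Q X (map_vec D w) = Q_op Q X (map_vec C y)"
    by auto
  then show thesis using that state_equation_iff[OF y] by blast
qed

text \<open>The correspondence of the introduction, with \<open>v\<close> and \<open>y\<close> determining each other through
  \<open>V (y, w) = (0, v)\<close> and \<open>w = Q(X) v\<close>.\<close>

lemma transfer_op_kernel_iff_eigenvalue: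
  fixes Q :: "'d::finite \<Rightarrow> complex ^ 'r ^ 's"
    and D :: "'h::chilbert_space ^ 's \<Rightarrow> 'h ^ 'r"
  assumes X: "X \<in> nc_ball_level Q n"
    and lin: "bounded_clinear A" "bounded_clinear B" "bounded_clinear C" "bounded_clinear D"
    and V: "unitary_op (block_op A B C D)"
  shows "(\<exists>y\<in>carrier_vec n. y \<noteq> 0\<^sub>v n \<and> transfer_op Q A B C D n X y = 0\<^sub>v n)
    \<longleftrightarrow> nc_Q_eigenvalue Q (cadjoint D) n X"
proof -
  have blin: "bounded_linear A" "bounded_linear B" "bounded_linear C" "bounded_linear D"
    using lin by (simp_all add: bounded_clinear_def)
  have zero [simp]: "A 0 = 0" "B 0 = 0" "C 0 = 0"
    using blin by (simp_all add: linear_0 bounded_linear.linear)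
  note energy = colligation_norm[OF V]
  note adj = cadjoint_eq_iff_colligation[OF V zero(1,3)]
  have "norm (D w) \<le> norm w" for w
  proof (rule power2_le_imp_le)
    have "(norm (B w))\<^sup>2 + (norm (D w))\<^sup>2 = (norm w)\<^sup>2"
      using energy[of 0 w] by (simp only: zero add_0 norm_zero) simp
    then show "(norm (D w))\<^sup>2 \<le> (norm w)\<^sup>2"
      using zero_le_power2[of "norm (B w)"] by linarith
  qed simp
  note bij = transfer_op_bij_betw[OF X blin(4) this]
  show ?thesis
  proof
    assume "\<exists>y\<in>carrier_vec n. y \<noteq> 0\<^sub>v n \<and> transfer_op Q A B C D n X y = 0\<^sub>v n"
    then obtain y where y: "y \<in> carrier_vec n" "y \<noteq> 0\<^sub>v n"
      and root: "transfer_op Q A B C D n X y = 0\<^sub>v n" by blast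
    obtain w where w: "w \<in> carrier_vec n" and state: "w = Q_op Q X (map_vec C y + map_vec D w)"
      using state_equation_solvable[OF bij y(1)] by blast
    define v where "v = map_vec C y + map_vec D w"
    have v: "v \<in> carrier_vec n" using y w by (simp add: v_def)
    have out: "map_vec A y + map_vec B w = 0\<^sub>v n"
      using root transfer_op_eqI[OF bij y(1) w state] by simp
    have zero_out: "A (y $v i) + B (w $v i) = 0" if "i < n" for i
      using that y w arg_cong[OF out, of "\<lambda>u. u $v i"] by simp
    have v_nth: "v $v i = C (y $v i) + D (w $v i)" if "i < n" for i
      using that y w by (simp add: v_def)
    have "map_vec (cadjoint D) v = w"
      using v w zero_out v_nth adj by (intro eq_vecI) auto
    moreover have "v \<noteq> 0\<^sub>v n"
    proof
      assume "v = 0\<^sub>v n"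
      then have "y $v i = 0" if "i < n" for i
        using energy[of "y $v i" "w $v i"] zero_out[OF that] v_nth[OF that] that
        by (simp add: add_nonneg_eq_0_iff)
      then show False using y by auto
    qed
    ultimately show "nc_Q_eigenvalue Q (cadjoint D) n X"
      using X v state unfolding nc_Q_eigenvalue_def nc_ball_level_def v_def by auto
  next
    assume "nc_Q_eigenvalue Q (cadjoint D) n X"
    then obtain v where v: "v \<in> carrier_vec n" "v \<noteq> 0\<^sub>v n"
      and eig: "map_vec (cadjoint D) v = Q_op Q X v"
      by (auto simp: nc_Q_eigenvalue_def)
    define w where "w = Q_op Q X v"
    have w: "w \<in> carrier_vec n" using v by (simp add: w_def)
    have "cadjoint D (v $v i) = w $v i" if "i < n" for i
      using that v arg_cong[OF eig, of "\<lambda>u. u $v i"] by (simp add: w_def)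
    then have "\<exists>y. A y + B (w $v i) = 0 \<and> C y + D (w $v i) = v $v i" if "i < n" for i
      using adj that by blast
    then obtain g where g: "\<And>i. i < n \<Longrightarrow> A (g i) + B (w $v i) = 0 \<and> C (g i) + D (w $v i) = v $v i"
      by metis
    define y where "y = Matrix.vec n g"
    have y: "y \<in> carrier_vec n" by (simp add: y_def)
    have "map_vec C y + map_vec D w = v"
      using v w g by (intro eq_vecI) (auto simp: y_def)
    then have "transfer_op Q A B C D n X y = map_vec A y + map_vec B w"
      by (intro transfer_op_eqI[OF bij y w]) (simp add: w_def)
    also have "\<dots> = 0\<^sub>v n"
      using w g by (intro eq_vecI) (auto simp: y_def)
    finally have root: "transfer_op Q A B C D n X y = 0\<^sub>v n" .
    \<comment> \<open>With \<open>y = 0\<close> the energy balance of \<open>V\<close> would leave \<open>\<parallel>v\<parallel> = \<parallel>Q(X) v\<parallel>\<close>.\<close>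
    have "y \<noteq> 0\<^sub>v n"
    proof
      assume y0: "y = 0\<^sub>v n"
      have "norm (v $v i) = norm (w $v i)" if "i < n" for i
      proof -
        have "g i = 0" using y0 that by (metis y_def index_vec index_zero_vec(1))
        then show ?thesis
          using energy[of 0 "w $v i"] g[OF that] by simp
      qed
      then have "l2norm v = l2norm w"
        using v w unfolding l2norm_conv_L2_set by (intro L2_set_cong) auto
      also have "\<dots> \<le> op_norm n (Q_op Q X :: (complex ^ 'r) Matrix.vec \<Rightarrow> (complex ^ 's) Matrix.vec) * l2norm v"
        unfolding w_def by (rule l2norm_Q_op_le[OF v(1)])
      finally have "l2norm v = 0"
        using X unfolding nc_ball_level_def
        by (intro contraction_fixed_imp_zero) auto
      then show False using v by (simp add: l2norm_eq_0_iff[of _ n])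
    qed
    with y root show "\<exists>y\<in>carrier_vec n. y \<noteq> 0\<^sub>v n \<and> transfer_op Q A B C D n X y = 0\<^sub>v n"
      by blast
  qed
qed

theorem theorem3:
  fixes Q :: "'d::finite \<Rightarrow> complex ^ 'r ^ 's"
    and f :: "('d \<Rightarrow> complex mat) \<Rightarrow> complex mat"
    and A :: "complex \<Rightarrow> complex"
    and B :: "'h::chilbert_space ^ 's \<Rightarrow> complex"
    and C :: "complex \<Rightarrow> 'h ^ 'r"
    and D :: "'h ^ 's \<Rightarrow> 'h ^ 'r"
  assumes "lin_indep_family Q"
    and "f \<in> schur_agler Q"
    and "\<not> nc_constant Q f"
    and "has_unitary_realization Q f A B C D"
  shows "zero_locus Q f = nc_point_spectrum Q (cadjoint D) \<inter> nc_ball Q"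
proof -
  have lin: "bounded_clinear A" "bounded_clinear B" "bounded_clinear C" "bounded_clinear D"
    and V: "unitary_op (block_op A B C D)"
    and f: "\<And>n X y. \<lbrakk>1 \<le> n; X \<in> nc_ball_level Q n; y \<in> carrier_vec n\<rbrakk>
      \<Longrightarrow> f X *\<^sub>v y = transfer_op Q A B C D n X y"
    using assms(4) by (auto simp: has_unitary_realization_def)
  have level: "Determinant.det (f X) = 0 \<longleftrightarrow> nc_Q_eigenvalue Q (cadjoint D) n X"
    if n: "1 \<le> n" and X: "X \<in> nc_ball_level Q n" for n X
  proof -
    have "f X \<in> carrier_mat n n"
      using assms(2) n X by (auto simp: schur_agler_def nc_function_def)
    from det_0_iff_vec_prod_zero[OF this]
      transfer_op_kernel_iff_eigenvalue[OF X lin V] f[OF n X]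
    show ?thesis by auto
  qed
  \<comment> \<open>Spectrum and ball are unions over all levels; a tuple \<open>X\<close> lies on only one, as \<open>'d\<close> is nonempty.\<close>
  have level_unique: "m = n" if "X \<in> nc_level m" "X \<in> nc_level n"
    for m n and X :: "'d \<Rightarrow> complex mat"
    using that unfolding nc_level_def by (metis carrier_matD(1) mem_Collect_eq)
  show ?thesis
  proof (intro equalityI subsetI)
    fix X assume "X \<in> zero_locus Q f"
    then obtain n where "1 \<le> n" "X \<in> nc_ball_level Q n" "Determinant.det (f X) = 0"
      by (auto simp: zero_locus_def nc_ball_def)
    then show "X \<in> nc_point_spectrum Q (cadjoint D) \<inter> nc_ball Q"
      using level by (auto simp: nc_point_spectrum_def nc_ball_def)
  next
    fix X assume "X \<in> nc_point_spectrum Q (cadjoint D) \<inter> nc_ball Q"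
    then obtain m n where "nc_Q_eigenvalue Q (cadjoint D) m X"
      and n: "1 \<le> n" "X \<in> nc_ball_level Q n"
      by (auto simp: nc_point_spectrum_def nc_ball_def)
    moreover from this have "m = n"
      by (intro level_unique) (auto simp: nc_Q_eigenvalue_def nc_ball_level_def)
    ultimately show "X \<in> zero_locus Q f"
      using level by (auto simp: zero_locus_def nc_ball_def)
  qed
qed

end
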